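(* Let $0\le k\le n$ be integers. Then $$\frac{\{n\}!}{\{k\}!\,\{n-k\}!}=\sum_{B}\operatorname{wt}B,$$ where the sum is over all binomial partial tilings $B$ associated with lattice paths from $(k,0)$ to $(0,n)$ in $\delta_n$. Consequently the Lucasnomial $\left\{{n\atop k}\right\}=\frac{\{n\}!}{\{k\}!\{n-k\}!}$ lies in $\mathbb{N}[s,t]$.
   Context: Let $s,t$ be indeterminates and $\mathbb{N}=\{0,1,2,\dots\}$. The Lucas sequence is $\{0\}=0$, $\{1\}=1$, $\{n\}=s\{n-1\}+t\{n-2\}$ for $n\ge 2$; $\{n\}!=\{1\}\{2\}\cdots\{n\}$ with $\{0\}!=1$. The staircase $\delta_n=(n-1,n-2,\dots,1)$ is drawn in the first quadrant with unit boxes, southwest corner at the origin, the $i$th row from the bottom having $n-i$ boxes (row $n$ is regarded as having $0$ boxes). The unit segments from $(n-1,0)$ to $(n,0)$ and from $(0,n-1)$ to $(0,n)$ are also considered part of the diagram. A tiling of $\delta_n$ is a tiling of each row by monominoes (one box) and dominoes (two adjacent boxes of a row). Given a tiling $T$ of $\delta_n$, its path $p$ starts at $(k,0)$ and ends at $(0,n)$: from a lattice point $(x,y)$ it takes a unit north step $N$ to $(x,y+1)$ if doing so does not cross a domino of $T$ (i.e. $T$ has no domino in row $y+1$ covering the $x$th and $(x+1)$st boxes) and does not leave the diagram; otherwise it takes a unit west step $W$ to $(x-1,y)$. An $N$ step is an $NL$ step if it is immediately preceded by a $W$ step, and an $NI$ step otherwise. The binomial partial tiling $B$ associated with $T$ consists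 of the path $p$ together with the tiles of $T$ that lie, in the row of each $NL$ step, to the right of that step and, in the row of each $NI$ step, to the left of that step; all other boxes are left blank. Different $T$ giving the same path and the same such tiles give the same binomial partial tiling, which is counted once. The weight is $\operatorname{wt}B=s^{\#\text{monominoes in }B}\,t^{\#\text{dominoes in }B}$. *)

theory Defs
  imports
    "HOL-Library.Disjoint_Sets"
    "HOL-Computational_Algebra.Polynomial_Factorial"
begin

section \<open>Lucasnomials\<close>

text \<open>
  The ring of integer polynomials in \<open>s\<close> and \<open>t\<close> is \<^typ>\<open>int poly poly\<close>: the inner variable
  is \<open>s\<close>, the outer one is \<open>t\<close>, so the coefficient of \<open>s\<^sup>i t\<^sup>j\<close> in \<open>p\<close> is \<open>coeff (coeff p j) i\<close>.
  Quotients are formed in the field of fractions \<^typ>\<open>int poly poly fract\<close>.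
\<close>

definition var_s :: "int poly poly" where
  "var_s = [:[:0, 1:]:]"

definition var_t :: "int poly poly" where
  "var_t = [:0, 1:]"

text \<open>The semiring of polynomials in \<open>s\<close> and \<open>t\<close> with natural number coefficients.\<close>

definition nat_polys :: "int poly poly set" where
  "nat_polys = {p. \<forall>i j. 0 \<le> coeff (coeff p j) i}"

fun lucas :: "nat \<Rightarrow> int poly poly" where
  "lucas 0 = 0"
| "lucas (Suc 0) = 1"
| "lucas (Suc (Suc n)) = var_s * lucas (Suc n) + var_t * lucas n"

definition lucas_fact :: "nat \<Rightarrow> int poly poly" where
  "lucas_fact n = (\<Prod>i = 1..n. lucas i)"

text \<open>Only meaningful for \<open>k \<le> n\<close>, because \<open>n - k\<close> is truncated subtraction.\<close>

definition lucasnomial :: "nat \<Rightarrow> nat \<Rightarrow> int poly poly fract" where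
  "lucasnomial n k =
     to_fract (lucas_fact n) / (to_fract (lucas_fact k) * to_fract (lucas_fact (n - k)))"


section \<open>Tilings of the staircase\<close>

text \<open>
  A pair \<open>(x, y)\<close> with \<open>x, y \<ge> 1\<close> used as a box is the \<open>x\<close>th box, from the left, of the \<open>y\<close>th row,
  from the bottom; geometrically it is the unit square \<open>[x - 1, x] \<times> [y - 1, y]\<close>.
  A tile is identified with the set of boxes that it covers.
\<close>

type_synonym box = "nat \<times> nat"
type_synonym point = "nat \<times> nat"
type_synonym tile = "box set"

definition staircase :: "nat \<Rightarrow> box set" where
  "staircase n = {(x, y). 1 \<le> y \<and> y \<le> n \<and> 1 \<le> x \<and> x \<le> n - y}"

definition monomino :: "tile \<Rightarrow> bool" where
  "monomino d \<longleftrightarrow> (\<exists>x y. d = {(x, y)})"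

definition domino :: "tile \<Rightarrow> bool" where
  "domino d \<longleftrightarrow> (\<exists>x y. d = {(x, y), (Suc x, y)})"

definition tiling :: "nat \<Rightarrow> tile set \<Rightarrow> bool" where
  "tiling n T \<longleftrightarrow> partition_on (staircase n) T \<and> (\<forall>d\<in>T. monomino d \<or> domino d)"


section \<open>The path of a tiling\<close>

text \<open>
  The segment from the lattice point \<open>(x, y)\<close> to \<open>(x, y + 1)\<close> lies in the diagram iff
  \<open>x + (y + 1) \<le> n\<close>: for \<open>y + 1 < n\<close> it borders a box of row \<open>y + 1\<close>, which has \<open>n - (y + 1)\<close>
  boxes, and for \<open>y + 1 = n\<close> the only such segment is the extra one from \<open>(0, n - 1)\<close> to \<open>(0, n)\<close>.
\<close>

definition north_allowed :: "nat \<Rightarrow> tile set \<Rightarrow> point \<Rightarrow> bool" where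
  "north_allowed n T = (\<lambda>(x, y). x + Suc y \<le> n \<and> {(x, Suc y), (Suc x, Suc y)} \<notin> T)"

text \<open>
  The list of lattice points visited from \<open>(x, y)\<close> on. In a tiling no domino covers the boxes \<open>0\<close>
  and \<open>1\<close> of a row, since boxes are numbered from \<open>1\<close>, so a path that started at \<open>(k, 0)\<close> with
  \<open>k \<le> n\<close> can only stop at \<open>(0, n)\<close>; see \<open>last_tiling_path\<close> below.
\<close>

function path_from :: "nat \<Rightarrow> tile set \<Rightarrow> point \<Rightarrow> point list" where
  "path_from n T (x, y) = (x, y) #
     (if north_allowed n T (x, y) then path_from n T (x, Suc y)
      else if x > 0 then path_from n T (x - 1, y)
      else [])"
  by pat_completeness auto
termination
  by (relation "measure (\<lambda>(n, T, x, y). x + (n - y))") (auto simp: north_allowed_def)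

declare path_from.simps [simp del]

definition tiling_path :: "nat \<Rightarrow> nat \<Rightarrow> tile set \<Rightarrow> point list" where
  "tiling_path n k T = path_from n T (k, 0)"

lemma last_path_from:
  assumes "tiling n T" and "fst q + snd q \<le> n"
  shows "last (path_from n T q) = (0, n)"
  using assms
proof (induction n T q rule: path_from.induct)
  case (1 n T x y)
  have no: "{(0, Suc y), (Suc 0, Suc y)} \<notin> T"
  proof
    assume "{(0, Suc y), (Suc 0, Suc y)} \<in> T"
    then have "(0, Suc y) \<in> \<Union>T" by blast
    then show False
      using 1(3) by (auto simp: tiling_def partition_on_def staircase_def)
  qed
  have ne: "path_from m S r \<noteq> []" for m S r
    by (cases r) (simp add: path_from.simps)
  consider "north_allowed n T (x, y)" | "\<not> north_allowed n T (x, y)" "x > 0"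
    | "\<not> north_allowed n T (x, y)" "x = 0" by blast
  then show ?case
  proof cases
    case 1
    then show ?thesis
      using "1.IH"(1) "1.prems" ne by (subst path_from.simps) (auto simp: north_allowed_def)
  next
    case 2
    then show ?thesis
      using "1.IH"(2) "1.prems" ne by (subst path_from.simps) auto
  next
    case 3
    then show ?thesis
      using no "1.prems" by (subst path_from.simps) (auto simp: north_allowed_def)
  qed
qed

lemma last_tiling_path:
  assumes "tiling n T" and "k \<le> n"
  shows "last (tiling_path n k T) = (0, n)"
  unfolding tiling_path_def using assms by (intro last_path_from) auto


section \<open>Binomial partial tilings\<close>

text \<open>The \<open>i\<close>th step of a path \<open>p\<close> leads from \<open>p ! i\<close> to \<open>p ! Suc i\<close>, counting from \<open>0\<close>.\<close>

definition N_step :: "point list \<Rightarrow> nat \<Rightarrow> bool" where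
  "N_step p i \<longleftrightarrow> Suc i < length p \<and> p ! Suc i = (fst (p ! i), Suc (snd (p ! i)))"

definition W_step :: "point list \<Rightarrow> nat \<Rightarrow> bool" where
  "W_step p i \<longleftrightarrow> Suc i < length p \<and> p ! i = (Suc (fst (p ! Suc i)), snd (p ! Suc i))"

definition NL_step :: "point list \<Rightarrow> nat \<Rightarrow> bool" where
  "NL_step p i \<longleftrightarrow> N_step p i \<and> i > 0 \<and> W_step p (i - 1)"

definition NI_step :: "point list \<Rightarrow> nat \<Rightarrow> bool" where
  "NI_step p i \<longleftrightarrow> N_step p i \<and> \<not> NL_step p i"

text \<open>
  The boxes of row \<open>y + 1\<close> to the left and to the right of the segment from \<open>(x, y)\<close> to
  \<open>(x, y + 1)\<close>.
\<close>

definition left_of :: "point \<Rightarrow> box set" where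
  "left_of = (\<lambda>(x, y). {(a, b). b = Suc y \<and> a \<le> x})"

definition right_of :: "point \<Rightarrow> box set" where
  "right_of = (\<lambda>(x, y). {(a, b). b = Suc y \<and> x < a})"

definition kept_tiles :: "tile set \<Rightarrow> point list \<Rightarrow> tile set" where
  "kept_tiles T p =
     {d \<in> T. \<exists>i. NL_step p i \<and> d \<subseteq> right_of (p ! i) \<or> NI_step p i \<and> d \<subseteq> left_of (p ! i)}"

type_synonym partial_tiling = "point list \<times> tile set"

definition binomial_partial_tiling :: "nat \<Rightarrow> nat \<Rightarrow> tile set \<Rightarrow> partial_tiling" where
  "binomial_partial_tiling n k T = (tiling_path n k T, kept_tiles T (tiling_path n k T))"

definition binomial_partial_tilings :: "nat \<Rightarrow> nat \<Rightarrow> partial_tiling set" where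
  "binomial_partial_tilings n k = binomial_partial_tiling n k ` {T. tiling n T}"

definition wt :: "partial_tiling \<Rightarrow> int poly poly" where
  "wt B = var_s ^ card {d \<in> snd B. monomino d} * var_t ^ card {d \<in> snd B. domino d}"

end

theory Submission
  imports Defs
begin

text \<open>
  Write \<open>{m}\<close> for the Lucas polynomial \<open>lucas m\<close>. The tilings of a strip of \<open>m\<close> boxes have total
  weight \<open>{m + 1}\<close>, since removing the first tile gives the Lucas recurrence
  (\<open>sum_tilings_strip\<close>). The theorem follows by reading a binomial partial tiling row by row.

  Let the path stand at \<open>(x, y)\<close> with \<open>x + y < n\<close>. If no domino blocks it, it goes north by an
  \<open>NI\<close> step, and what is kept of row \<open>y + 1\<close> is an arbitrary tiling of the \<open>x\<close> boxes on the left, of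
  total weight \<open>{x + 1}\<close>. If a domino blocks it, it goes west once, and then north by an
  \<open>NL\<close> step: a second blocking domino would overlap the first. What is kept is then a tiling of the
  \<open>n - y - x\<close> boxes right of the step that begins with the blocking domino, and these tilings have
  total weight \<open>t {n - y - x - 1}\<close>. The boxes on the other side of the north step are blank, so
  they can be tiled in any way without affecting the result, and the rows above contribute an
  arbitrary partial tiling of the same kind. Hence the total weight \<open>W(x, y)\<close> of the partial
  tilings that start at \<open>(x, y)\<close> satisfies
  \<open>W(x, y) = {x + 1} W(x, y + 1) + t {n - y - x - 1} W(x - 1, y + 1)\<close>
  (\<open>sum_partials_interior\<close>; for \<open>x = 0\<close> the second term is absent). On the line \<open>x + y = n\<close> the edge
  of the diagram forces a west step followed by a north step with no box to its right.

  The quotients \<open>{n - y}! / ({x}! {n - y - x}!)\<close> satisfy the same recurrence because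
  \<open>{x + m + 1} = {x + 1} {m + 1} + t {x} {m}\<close> (\<open>lucas_add\<close>). In \<open>sum_partials\<close> the resulting
  equality is proved inside the polynomial ring, with the denominators multiplied out; starting at
  \<open>(k, 0)\<close> it gives the theorem. Coefficients are nonnegative because every weight is a
  monomial.
\<close>

section \<open>Lucas polynomials\<close>

text \<open>
  In terms of strips: cut a strip of \<open>x + m\<close> boxes after the first \<open>x\<close>. Either no domino crosses the
  cut, or one does and leaves \<open>x - 1\<close> and \<open>m - 1\<close> boxes. The proof is the algebraic one.
\<close>

lemma lucas_add:
  "lucas (x + Suc m) = lucas (Suc x) * lucas (Suc m) + var_t * lucas x * lucas m"
proof (induction m rule: lucas.induct)
  case 1
  show ?case by simp
next
  case 2
  show ?case by (simp add: algebra_simps)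
next
  case (3 m)
  have "lucas (x + Suc (Suc (Suc m))) = var_s * lucas (x + Suc (Suc m)) + var_t * lucas (x + Suc m)"
    by simp
  also have "\<dots> = lucas (Suc x) * lucas (Suc (Suc (Suc m))) + var_t * lucas x * lucas (Suc (Suc m))"
    by (subst "3.IH"(1), subst "3.IH"(2)) (simp add: algebra_simps)
  finally show ?case .
qed

text \<open>
  Setting \<open>t = 0\<close> leaves a power of \<open>s\<close>; this makes the denominators of the Lucasnomials nonzero.
\<close>

lemma lucas_at_t_0: "poly (lucas (Suc n)) 0 = [:0, 1:] ^ n"
  by (induction n rule: lucas.induct) (simp_all add: var_s_def var_t_def)

lemma lucas_fact_nonzero: "lucas_fact n \<noteq> 0"
proof -
  have "lucas i \<noteq> 0" if "i \<ge> 1" for i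
  proof -
    from that obtain j where "i = Suc j" by (cases i) auto
    moreover have "poly (lucas (Suc j)) 0 \<noteq> 0" by (simp add: lucas_at_t_0)
    ultimately show ?thesis by auto
  qed
  then show ?thesis by (auto simp: lucas_fact_def)
qed

lemma lucas_fact_Suc: "lucas_fact (Suc n) = lucas_fact n * lucas (Suc n)"
  by (simp add: lucas_fact_def)

section \<open>Polynomials with natural number coefficients\<close>

lemma nat_polys_0: "0 \<in> nat_polys"
  by (simp add: nat_polys_def)

lemma nat_polys_add: "p \<in> nat_polys \<Longrightarrow> q \<in> nat_polys \<Longrightarrow> p + q \<in> nat_polys"
  by (simp add: nat_polys_def)

lemma nat_polys_mult: "p \<in> nat_polys \<Longrightarrow> q \<in> nat_polys \<Longrightarrow> p * q \<in> nat_polys"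
  by (auto simp: nat_polys_def coeff_mult coeff_sum intro!: sum_nonneg)

lemma nat_polys_1: "1 \<in> nat_polys"
  by (simp add: nat_polys_def coeff_1)

lemma nat_polys_power: "p \<in> nat_polys \<Longrightarrow> p ^ m \<in> nat_polys"
  by (induction m) (simp_all add: nat_polys_1 nat_polys_mult)

lemma nat_polys_sum: "(\<And>i. i \<in> I \<Longrightarrow> f i \<in> nat_polys) \<Longrightarrow> sum f I \<in> nat_polys"
  by (induction I rule: infinite_finite_induct) (auto intro: nat_polys_0 nat_polys_add)

lemma var_in_nat_polys: "var_s \<in> nat_polys" "var_t \<in> nat_polys"
  by (auto simp: nat_polys_def var_s_def var_t_def coeff_pCons coeff_1 split: nat.splits)

lemma wt_in_nat_polys: "wt B \<in> nat_polys"
  unfolding wt_def by (intro nat_polys_mult nat_polys_power var_in_nat_polys)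

section \<open>Tilings of sets of boxes\<close>

text \<open>
  Tilings of arbitrary sets of boxes are needed because the rows above a given one, and
  the two parts of a row, are tiled independently of each other.
\<close>

definition tilings :: "box set \<Rightarrow> tile set set" where
  "tilings A = {T. partition_on A T \<and> (\<forall>d\<in>T. monomino d \<or> domino d)}"

definition tile_weight :: "tile set \<Rightarrow> int poly poly" where
  "tile_weight T = var_s ^ card {d \<in> T. monomino d} * var_t ^ card {d \<in> T. domino d}"

lemma tilingsD:
  assumes "T \<in> tilings A"
  shows "\<Union>T = A" and "d \<in> T \<Longrightarrow> d \<subseteq> A" and "d \<in> T \<Longrightarrow> d \<noteq> {}"
    and "d \<in> T \<Longrightarrow> e \<in> T \<Longrightarrow> z \<in> d \<Longrightarrow> z \<in> e \<Longrightarrow> d = e"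
    and "d \<in> T \<Longrightarrow> monomino d \<or> domino d"
  using assms by (auto simp: tilings_def partition_on_def disjoint_def)

lemma tilingsI:
  assumes "\<Union>T = A" and "\<And>d e z. d \<in> T \<Longrightarrow> e \<in> T \<Longrightarrow> z \<in> d \<Longrightarrow> z \<in> e \<Longrightarrow> d = e"
    and "\<And>d. d \<in> T \<Longrightarrow> monomino d \<or> domino d"
  shows "T \<in> tilings A"
proof -
  have "{} \<notin> T" using assms(3) by (auto simp: monomino_def domino_def)
  with assms show ?thesis
    unfolding tilings_def partition_on_def disjoint_def by blast
qed

lemma finite_tilings: "finite A \<Longrightarrow> finite (tilings A)"
  by (rule finite_subset[of _ "Pow (Pow A)"]) (auto dest: tilingsD(2))

lemma finite_tiling: "finite A \<Longrightarrow> T \<in> tilings A \<Longrightarrow> finite T"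
  using tilingsD(1) finite_UnionD by metis

lemma tilings_nonempty: "tilings A \<noteq> {}"
proof -
  have "(\<lambda>z. {z}) ` A \<in> tilings A"
    by (rule tilingsI) (auto simp: monomino_def)
  then show ?thesis by blast
qed

lemma tilings_empty: "tilings {} = {{}}"
proof
  show "tilings {} \<subseteq> {{}}" using tilingsD(2,3) by blast
  show "{{}} \<subseteq> tilings {}" by (auto intro: tilingsI)
qed

lemma tilings_Un:
  assumes "U \<in> tilings A" and "V \<in> tilings B" and "A \<inter> B = {}"
  shows "U \<union> V \<in> tilings (A \<union> B)"
proof (rule tilingsI)
  show "\<Union>(U \<union> V) = A \<union> B" using assms tilingsD(1) by auto
  show "d = e" if "d \<in> U \<union> V" "e \<in> U \<union> V" "z \<in> d" "z \<in> e" for d e z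
    using that assms tilingsD(2)[OF assms(1)] tilingsD(2)[OF assms(2)]
      tilingsD(4)[OF assms(1)] tilingsD(4)[OF assms(2)] by blast
  show "monomino d \<or> domino d" if "d \<in> U \<union> V" for d
    using that tilingsD(5)[OF assms(1)] tilingsD(5)[OF assms(2)] by blast
qed

text \<open>
  The third premise says that no tile crosses the border of \<open>C\<close>.
\<close>

lemma tilings_restrict:
  assumes "T \<in> tilings A" and "C \<subseteq> A" and "\<And>d. d \<in> T \<Longrightarrow> d \<subseteq> C \<or> d \<inter> C = {}"
  shows "{d \<in> T. d \<subseteq> C} \<in> tilings C"
proof (rule tilingsI)
  show "\<Union>{d \<in> T. d \<subseteq> C} = C"
  proof
    show "C \<subseteq> \<Union>{d \<in> T. d \<subseteq> C}"
    proof
      fix z assume "z \<in> C"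
      then obtain d where "d \<in> T" "z \<in> d" using assms(1,2) tilingsD(1) by blast
      with \<open>z \<in> C\<close> assms(3) show "z \<in> \<Union>{d \<in> T. d \<subseteq> C}" by blast
    qed
  qed auto
  show "d = e" if "d \<in> {d \<in> T. d \<subseteq> C}" "e \<in> {d \<in> T. d \<subseteq> C}" "z \<in> d" "z \<in> e" for d e z
    using that tilingsD(4)[OF assms(1)] by blast
  show "monomino d \<or> domino d" if "d \<in> {d \<in> T. d \<subseteq> C}" for d
    using that tilingsD(5)[OF assms(1)] by blast
qed

lemma tiles_inside_Un:
  assumes "U \<in> tilings A" and "V \<in> tilings B" and "A \<inter> B = {}"
  shows "{d \<in> U \<union> V. d \<subseteq> A} = U"
proof
  show "{d \<in> U \<union> V. d \<subseteq> A} \<subseteq> U"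
  proof
    fix d assume d: "d \<in> {d \<in> U \<union> V. d \<subseteq> A}"
    have "d \<notin> V"
    proof
      assume "d \<in> V"
      then have "d \<subseteq> B" "d \<noteq> {}" using tilingsD(2,3)[OF assms(2)] by auto
      with d assms(3) show False by auto
    qed
    with d show "d \<in> U" by simp
  qed
  show "U \<subseteq> {d \<in> U \<union> V. d \<subseteq> A}" using tilingsD(2)[OF assms(1)] by auto
qed

lemma tile_weight_Un:
  assumes "finite U" and "finite V" and "U \<inter> V = {}"
  shows "tile_weight (U \<union> V) = tile_weight U * tile_weight V"
proof -
  have "card {d \<in> U \<union> V. P d} = card {d \<in> U. P d} + card {d \<in> V. P d}" for P
  proof -
    have "{d \<in> U \<union> V. P d} = {d \<in> U. P d} \<union> {d \<in> V. P d}" by auto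
    then show ?thesis
      using assms by (simp add: card_Un_disjoint disjoint_iff)
  qed
  then show ?thesis
    by (simp add: tile_weight_def power_add algebra_simps)
qed

lemma tile_weight_monomino: "tile_weight {{z}} = var_s"
proof -
  have *: "{d \<in> {{z}}. monomino d} = {{z}}" "{d \<in> {{z}}. domino d} = {}"
    by (cases z; auto simp: monomino_def domino_def doubleton_eq_iff)+
  show ?thesis by (simp only: tile_weight_def *) simp
qed

lemma tile_weight_domino: "tile_weight {{(a, b), (Suc a, b)}} = var_t"
proof -
  have *: "{d \<in> {{(a, b), (Suc a, b)}}. monomino d} = {}"
    "{d \<in> {{(a, b), (Suc a, b)}}. domino d} = {{(a, b), (Suc a, b)}}"
    by (auto simp: monomino_def domino_def doubleton_eq_iff)
  show ?thesis by (simp only: tile_weight_def *) simp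
qed

text \<open>
  Removing \<open>d\<close> is a bijection from the tilings of \<open>A\<close> that contain \<open>d\<close> to the tilings of the rest.
\<close>

lemma sum_tilings_with_tile:
  assumes "finite A" and "d \<subseteq> A" and "monomino d \<or> domino d"
  shows "(\<Sum>T \<in> {T \<in> tilings A. d \<in> T}. tile_weight T)
    = tile_weight {d} * (\<Sum>T \<in> tilings (A - d). tile_weight T)"
proof -
  have d: "{d} \<in> tilings d" using assms(3) by (auto intro!: tilingsI)
  have ne: "d \<noteq> {}" using tilingsD(3)[OF d] by simp
  have "(\<Sum>T \<in> {T \<in> tilings A. d \<in> T}. tile_weight T)
    = (\<Sum>T \<in> tilings (A - d). tile_weight {d} * tile_weight T)"
  proof (rule sum.reindex_bij_witness[where i = "\<lambda>T. {d} \<union> T" and j = "\<lambda>T. {e \<in> T. e \<subseteq> A - d}"])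
    fix T assume T: "T \<in> {T \<in> tilings A. d \<in> T}"
    then have T': "T \<in> tilings A" "d \<in> T" by auto
    have cut: "e = d \<or> e \<subseteq> A - d" if "e \<in> T" for e
      using that T' tilingsD(2,4)[OF T'(1)] by blast
    show "{e \<in> T. e \<subseteq> A - d} \<in> tilings (A - d)"
      by (rule tilings_restrict[OF T'(1)]) (use cut in auto)
    show eq: "{d} \<union> {e \<in> T. e \<subseteq> A - d} = T" using cut T'(2) by auto
    have "finite T" using finite_tiling[OF assms(1)] T' by blast
    then have "tile_weight ({d} \<union> {e \<in> T. e \<subseteq> A - d})
      = tile_weight {d} * tile_weight {e \<in> T. e \<subseteq> A - d}"
      using ne by (intro tile_weight_Un) auto
    with eq show "tile_weight {d} * tile_weight {e \<in> T. e \<subseteq> A - d} = tile_weight T" by simp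
  next
    fix T assume T: "T \<in> tilings (A - d)"
    show "{d} \<union> T \<in> {T \<in> tilings A. d \<in> T}"
      using tilings_Un[OF d T] assms(2) by (simp add: Un_absorb1)
    show "{e \<in> {d} \<union> T. e \<subseteq> A - d} = T"
      using tiles_inside_Un[OF T d] by (simp only: Un_commute) auto
  qed
  then show ?thesis by (simp add: sum_distrib_left)
qed

section \<open>Tilings of a strip\<close>

text \<open>
  The strip consists of the boxes of row \<open>b\<close> between the vertical lines at \<open>l\<close> and \<open>r\<close>, so two strips
  that share a line are disjoint, and \<open>r - l\<close> is the number of boxes.
\<close>

definition strip :: "nat \<Rightarrow> nat \<Rightarrow> nat \<Rightarrow> box set" where
  "strip b l r = {l<..r} \<times> {b}"

lemma finite_strip: "finite (strip b l r)"
  by (simp add: strip_def)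

text \<open>
  The leftmost box lies in a monomino or in a domino, and removing this tile leaves a shorter strip.
\<close>

lemma sum_tilings_strip:
  "(\<Sum>T \<in> tilings (strip b l (l + m)). tile_weight T) = lucas (Suc m)"
proof (induction m arbitrary: l rule: lucas.induct)
  case 1
  show ?case by (simp add: strip_def tilings_empty tile_weight_def)
next
  case 2
  let ?A = "strip b l (l + Suc 0)" and ?d = "{(Suc l, b)}"
  have A: "?A = ?d" by (auto simp: strip_def)
  have "?d \<in> T" if "T \<in> tilings ?A" for T
  proof -
    from tilingsD(1)[OF that] A obtain d where "d \<in> T" "(Suc l, b) \<in> d" by blast
    moreover from this have "d \<subseteq> ?d" using tilingsD(2)[OF that] A by auto
    ultimately have "d = ?d" by blast
    with \<open>d \<in> T\<close> show ?thesis by simp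
  qed
  then have "tilings ?A = {T \<in> tilings ?A. ?d \<in> T}" by auto
  then have "(\<Sum>T \<in> tilings ?A. tile_weight T) = (\<Sum>T \<in> {T \<in> tilings ?A. ?d \<in> T}. tile_weight T)"
    by simp
  also have "\<dots> = tile_weight {?d} * (\<Sum>T \<in> tilings (?A - ?d). tile_weight T)"
    by (rule sum_tilings_with_tile) (auto simp: strip_def monomino_def)
  also have "\<dots> = var_s"
    using A by (simp add: tile_weight_monomino tilings_empty) (simp add: tile_weight_def)
  finally show ?case by simp
next
  case (3 m)
  let ?A = "strip b l (l + Suc (Suc m))"
  let ?m = "{(Suc l, b)}" and ?d = "{(Suc l, b), (Suc (Suc l), b)}"
  have md: "?m \<in> T \<or> ?d \<in> T" if T: "T \<in> tilings ?A" for T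
  proof -
    have "(Suc l, b) \<in> ?A" by (simp add: strip_def)
    with tilingsD(1)[OF T] obtain d where d: "d \<in> T" "(Suc l, b) \<in> d" by blast
    from tilingsD(2)[OF T d(1)] have "(l, b) \<notin> d" by (auto simp: strip_def)
    with tilingsD(5)[OF T d(1)] d(2) have "d = ?m \<or> d = ?d"
      by (auto simp: monomino_def domino_def)
    with d(1) show ?thesis by auto
  qed
  have not_both: "\<not> (?m \<in> T \<and> ?d \<in> T)" if T: "T \<in> tilings ?A" for T
    using tilingsD(4)[OF T, of ?m ?d "(Suc l, b)"] by auto
  have fin: "finite {T \<in> tilings ?A. P T}" for P
    using finite_tilings[OF finite_strip] by simp
  have "tilings ?A = {T \<in> tilings ?A. ?m \<in> T} \<union> {T \<in> tilings ?A. ?d \<in> T}"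
    using md by auto
  moreover have "(\<Sum>T \<in> {T \<in> tilings ?A. ?m \<in> T} \<union> {T \<in> tilings ?A. ?d \<in> T}. tile_weight T)
    = (\<Sum>T \<in> {T \<in> tilings ?A. ?m \<in> T}. tile_weight T) + (\<Sum>T \<in> {T \<in> tilings ?A. ?d \<in> T}. tile_weight T)"
    by (rule sum.union_disjoint[OF fin fin]) (use not_both in auto)
  moreover have "(\<Sum>T \<in> {T \<in> tilings ?A. ?m \<in> T}. tile_weight T)
    = tile_weight {?m} * (\<Sum>T \<in> tilings (?A - ?m). tile_weight T)"
    by (rule sum_tilings_with_tile) (auto simp: strip_def monomino_def)
  moreover have "?A - ?m = strip b (Suc l) (Suc l + Suc m)" by (auto simp: strip_def)
  moreover have "(\<Sum>T \<in> {T \<in> tilings ?A. ?d \<in> T}. tile_weight T)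
    = tile_weight {?d} * (\<Sum>T \<in> tilings (?A - ?d). tile_weight T)"
    by (rule sum_tilings_with_tile) (auto simp: strip_def domino_def)
  moreover have "?A - ?d = strip b (Suc (Suc l)) (Suc (Suc l) + m)" by (auto simp: strip_def)
  ultimately show ?case
    using "3.IH" by (simp only: tile_weight_monomino tile_weight_domino lucas.simps)
qed

text \<open>
  For \<open>r = l + 1\<close> the domino does not fit, in agreement with \<open>lucas 0 = 0\<close>.
\<close>

lemma sum_tilings_strip_domino_first:
  assumes "l < r"
  shows "(\<Sum>T \<in> {T \<in> tilings (strip b l r). {(Suc l, b), (Suc (Suc l), b)} \<in> T}. tile_weight T)
    = var_t * lucas (r - Suc l)"
proof (cases "r = Suc l")
  case True
  have "{T \<in> tilings (strip b l r). {(Suc l, b), (Suc (Suc l), b)} \<in> T} = {}"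
    using True by (auto dest!: tilingsD(2) simp: strip_def)
  then show ?thesis using True by (simp del: Collect_empty_eq)
next
  case False
  let ?d = "{(Suc l, b), (Suc (Suc l), b)}"
  from False assms obtain m where m: "r = Suc (Suc l) + m"
    by (metis Suc_leI le_antisym less_eqE not_less_eq_eq)
  have "strip b l r - ?d = strip b (Suc (Suc l)) (Suc (Suc l) + m)" by (auto simp: strip_def m)
  moreover have "(\<Sum>T \<in> {T \<in> tilings (strip b l r). ?d \<in> T}. tile_weight T)
    = tile_weight {?d} * (\<Sum>T \<in> tilings (strip b l r - ?d). tile_weight T)"
    by (rule sum_tilings_with_tile) (auto simp: strip_def domino_def m)
  moreover have "r - Suc l = Suc m" by (simp add: m)
  ultimately show ?thesis
    by (simp only: sum_tilings_strip tile_weight_domino)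
qed

section \<open>Paths and kept tiles above a given row\<close>

definition rows_above :: "nat \<Rightarrow> nat \<Rightarrow> box set" where
  "rows_above n y = {(a, b) \<in> staircase n. y < b}"

text \<open>
  The construction of binomial partial tilings with an arbitrary starting point. When it
  starts at \<open>(x, y)\<close>, only the rows above height \<open>y\<close> matter; so \<open>partials n (x, y)\<close> ranges over the
  tilings of these rows, and induction over \<open>y\<close> becomes possible.
\<close>

definition partial_from :: "nat \<Rightarrow> tile set \<Rightarrow> point \<Rightarrow> partial_tiling" where
  "partial_from n T q = (path_from n T q, kept_tiles T (path_from n T q))"

definition partials :: "nat \<Rightarrow> point \<Rightarrow> partial_tiling set" where
  "partials n = (\<lambda>(x, y). (\<lambda>T. partial_from n T (x, y)) ` tilings (rows_above n y))"

text \<open>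
  Here \<open>U\<close> are the tiles kept in one row and \<open>u\<close> are the points of the path in which it reaches and
  leaves that row at the bottom; \<open>(p, K)\<close> is a partial tiling of the rows above.
\<close>

definition prepend :: "point list \<Rightarrow> tile set \<times> partial_tiling \<Rightarrow> partial_tiling" where
  "prepend u = (\<lambda>(U, (p, K)). (u @ p, U \<union> K))"

lemma finite_rows_above: "finite (rows_above n y)"
proof -
  have "rows_above n y \<subseteq> {..n} \<times> {..n}" by (auto simp: rows_above_def staircase_def)
  then show ?thesis by (rule finite_subset) simp
qed

lemma finite_partials: "finite (partials n q)"
  by (cases q) (simp add: partials_def finite_tilings finite_rows_above)

lemma path_from_nonempty: "path_from n T q \<noteq> []"
  by (cases q) (simp add: path_from.simps)

lemma hd_path_from: "hd (path_from n T q) = q"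
  by (cases q) (simp add: path_from.simps)

lemma path_from_row_ge: "q' \<in> set (path_from n T q) \<Longrightarrow> snd q \<le> snd q'"
proof (induction n T q rule: path_from.induct)
  case (1 n T x y)
  from "1.prems" show ?case
    using "1.IH" by (subst (asm) path_from.simps) (fastforce split: if_splits)
qed

lemma kept_tiles_subset: "kept_tiles T p \<subseteq> T"
  by (auto simp: kept_tiles_def)

text \<open>
  A path looks only at the dominoes in the rows above its starting point.
\<close>

lemma path_from_cong:
  assumes "\<And>x b. snd q < b \<Longrightarrow> {(x, b), (Suc x, b)} \<in> T \<longleftrightarrow> {(x, b), (Suc x, b)} \<in> T'"
  shows "path_from n T q = path_from n T' q"
  using assms
proof (induction n T q rule: path_from.induct)
  case (1 n T x y)
  have na: "north_allowed n T (x, y) \<longleftrightarrow> north_allowed n T' (x, y)"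
    using "1.prems"[of "Suc y" x] by (simp add: north_allowed_def)
  show ?case
  proof (cases "north_allowed n T (x, y)")
    case True
    with "1.IH"(1) "1.prems" na show ?thesis by (simp add: path_from.simps[of n _ x y])
  next
    case False
    with "1.IH"(2) "1.prems" na show ?thesis by (simp add: path_from.simps[of n _ x y])
  qed
qed

text \<open>
  Tiles in rows below the starting point of a path neither block it nor are next to any of its
  steps.
\<close>

lemma partial_from_upper_rows:
  assumes T: "T \<in> tilings (rows_above n y)" and q: "y \<le> snd q"
  shows "partial_from n T q = partial_from n {d \<in> T. d \<subseteq> rows_above n (snd q)} q"
proof -
  let ?T = "{d \<in> T. d \<subseteq> rows_above n (snd q)}"
  have up: "d \<subseteq> rows_above n (snd q)" if "d \<in> T" "\<forall>z\<in>d. snd q < snd z" for d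
    using that tilingsD(2)[OF T] by (fastforce simp: rows_above_def)
  have path: "path_from n T q = path_from n ?T q"
  proof (rule path_from_cong)
    fix x b assume "snd q < b"
    then show "{(x, b), (Suc x, b)} \<in> T \<longleftrightarrow> {(x, b), (Suc x, b)} \<in> ?T"
      using up[of "{(x, b), (Suc x, b)}"] by auto
  qed
  have "d \<subseteq> rows_above n (snd q)"
    if "d \<in> T" and i: "Suc i < length (path_from n T q)"
      and "d \<subseteq> right_of (path_from n T q ! i) \<or> d \<subseteq> left_of (path_from n T q ! i)" for d i
  proof (rule up[OF that(1)], rule ballI)
    fix z assume "z \<in> d"
    with that(3) have "snd z = Suc (snd (path_from n T q ! i))"
      by (cases "path_from n T q ! i") (auto simp: right_of_def left_of_def)
    moreover have "snd q \<le> snd (path_from n T q ! i)"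
      using i by (intro path_from_row_ge[of _ n T] nth_mem) simp
    ultimately show "snd q < snd z" by simp
  qed
  then have "kept_tiles T (path_from n T q) = kept_tiles ?T (path_from n T q)"
    unfolding kept_tiles_def NL_step_def NI_step_def N_step_def by blast
  with path show ?thesis by (simp add: partial_from_def)
qed

text \<open>
  Prefixing one north step \<open>NI\<close> shifts the indices of all other steps and does not change their kind:
  the first step of \<open>p\<close> was not preceded by a west step, and it still is not.
\<close>

lemma kept_tiles_north:
  assumes "p \<noteq> []" and "hd p = (x, Suc y)"
  shows "kept_tiles T ((x, y) # p) = {d \<in> T. d \<subseteq> left_of (x, y)} \<union> kept_tiles T p"
proof -
  let ?p = "(x, y) # p"
  have p0: "p ! 0 = (x, Suc y)" using assms by (simp add: hd_conv_nth)
  have W: "W_step ?p (Suc i) \<longleftrightarrow> W_step p i" and N: "N_step ?p (Suc i) \<longleftrightarrow> N_step p i" for i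
    by (simp_all add: W_step_def N_step_def)
  have W0: "\<not> W_step ?p 0" and N0: "N_step ?p 0"
    using p0 assms(1) by (simp_all add: W_step_def N_step_def)
  have NL: "NL_step ?p (Suc i) \<longleftrightarrow> NL_step p i" for i
    using W W0 N by (cases i) (simp_all add: NL_step_def)
  have NI: "NI_step ?p (Suc i) \<longleftrightarrow> NI_step p i" for i
    by (simp add: NI_step_def NL N)
  have zero: "\<not> NL_step ?p 0" "NI_step ?p 0"
    using N0 by (simp_all add: NL_step_def NI_step_def)
  \<comment> \<open>Separates the new step from the shifted ones.\<close>
  have ex: "(\<exists>i. P i) \<longleftrightarrow> P 0 \<or> (\<exists>i. P (Suc i))" for P :: "nat \<Rightarrow> bool"
    by (metis not0_implies_Suc)
  show ?thesis
    unfolding kept_tiles_def by (subst ex) (auto simp: NL NI zero)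
qed

text \<open>
  The second of the two prefixed steps is an \<open>NL\<close> step and separates the west step from \<open>p\<close>, so the
  kinds of the steps of \<open>p\<close> remain the same.
\<close>

lemma kept_tiles_west_north:
  assumes "p \<noteq> []" and "hd p = (x, Suc y)"
  shows "kept_tiles T ((Suc x, y) # (x, y) # p) = {d \<in> T. d \<subseteq> right_of (x, y)} \<union> kept_tiles T p"
proof -
  let ?p = "(Suc x, y) # (x, y) # p"
  have p0: "p ! 0 = (x, Suc y)" using assms by (simp add: hd_conv_nth)
  have W: "W_step ?p (Suc (Suc i)) \<longleftrightarrow> W_step p i"
    and N: "N_step ?p (Suc (Suc i)) \<longleftrightarrow> N_step p i" for i
    by (simp_all add: W_step_def N_step_def)
  have steps: "W_step ?p 0" "\<not> N_step ?p 0" "\<not> W_step ?p 1" "N_step ?p 1"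
    using p0 assms(1) by (simp_all add: W_step_def N_step_def)
  have NL: "NL_step ?p (Suc (Suc i)) \<longleftrightarrow> NL_step p i" for i
    using W steps N by (cases i) (simp_all add: NL_step_def)
  have NI: "NI_step ?p (Suc (Suc i)) \<longleftrightarrow> NI_step p i" for i
    by (simp add: NI_step_def NL N)
  have first: "\<not> NL_step ?p 0" "\<not> NI_step ?p 0" "NL_step ?p (Suc 0)" "\<not> NI_step ?p (Suc 0)"
    using steps by (simp_all add: NL_step_def NI_step_def)
  \<comment> \<open>Separates the two new steps from the shifted ones.\<close>
  have ex: "(\<exists>i. P i) \<longleftrightarrow> P 0 \<or> P (Suc 0) \<or> (\<exists>i. P (Suc (Suc i)))" for P :: "nat \<Rightarrow> bool"
    by (metis not0_implies_Suc)
  show ?thesis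
    unfolding kept_tiles_def by (subst ex) (auto simp: NL NI first)
qed

section \<open>Partial tilings row by row\<close>

lemma partial_from_north:
  assumes T: "T \<in> tilings (rows_above n y)" and north: "north_allowed n T (x, y)"
  shows "partial_from n T (x, y) = prepend [(x, y)]
    ({d \<in> T. d \<subseteq> strip (Suc y) 0 x}, partial_from n {d \<in> T. d \<subseteq> rows_above n (Suc y)} (x, Suc y))"
proof -
  let ?p = "path_from n T (x, Suc y)"
  have path: "path_from n T (x, y) = (x, y) # ?p"
    using north by (simp add: path_from.simps[of n T x y])
  have "{d \<in> T. d \<subseteq> left_of (x, y)} = {d \<in> T. d \<subseteq> strip (Suc y) 0 x}"
    using tilingsD(2)[OF T]
    by (fastforce simp: left_of_def strip_def rows_above_def staircase_def)
  then have "kept_tiles T ((x, y) # ?p) = {d \<in> T. d \<subseteq> strip (Suc y) 0 x} \<union> kept_tiles T ?p"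
    using kept_tiles_north[of ?p x y T] by (simp add: path_from_nonempty hd_path_from)
  then have "partial_from n T (x, y) = prepend [(x, y)]
      ({d \<in> T. d \<subseteq> strip (Suc y) 0 x}, partial_from n T (x, Suc y))"
    by (simp add: partial_from_def prepend_def path)
  then show ?thesis
    using partial_from_upper_rows[OF T, of "(x, Suc y)"] by simp
qed

text \<open>
  A west step is always followed by a north step. If it was caused by a domino, then this domino
  covers the box on the right of the next segment, and a second domino across that segment would
  overlap it. If it was caused by the edge of the diagram, then the next segment has no box on its
  right.
\<close>

lemma partial_from_west:
  assumes T: "T \<in> tilings (rows_above n y)" and le: "Suc x + y \<le> n"
    and no_north: "\<not> north_allowed n T (Suc x, y)"
  shows "partial_from n T (Suc x, y) = prepend [(Suc x, y), (x, y)]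
    ({d \<in> T. d \<subseteq> strip (Suc y) x (n - Suc y)},
      partial_from n {d \<in> T. d \<subseteq> rows_above n (Suc y)} (x, Suc y))"
proof -
  let ?p = "path_from n T (x, Suc y)"
  let ?D = "{(Suc x, Suc y), (Suc (Suc x), Suc y)}" and ?E = "{(x, Suc y), (Suc x, Suc y)}"
  have "?E \<notin> T"
  proof
    assume E: "?E \<in> T"
    then have "(Suc x, Suc y) \<in> rows_above n y" using tilingsD(2)[OF T] by blast
    then have "Suc x + Suc y \<le> n" by (auto simp: rows_above_def staircase_def)
    with no_north have "?D \<in> T" by (simp add: north_allowed_def)
    with E have "?D = ?E" using tilingsD(4)[OF T, of ?D ?E "(Suc x, Suc y)"] by simp
    then show False by (simp add: doubleton_eq_iff)
  qed
  with le have "north_allowed n T (x, y)" by (simp add: north_allowed_def)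
  with no_north have path: "path_from n T (Suc x, y) = (Suc x, y) # (x, y) # ?p"
    by (simp add: path_from.simps[of n T x y] path_from.simps[of n T "Suc x" y])
  have "{d \<in> T. d \<subseteq> right_of (x, y)} = {d \<in> T. d \<subseteq> strip (Suc y) x (n - Suc y)}"
    using tilingsD(2)[OF T]
    by (fastforce simp: right_of_def strip_def rows_above_def staircase_def)
  then have "kept_tiles T ((Suc x, y) # (x, y) # ?p)
    = {d \<in> T. d \<subseteq> strip (Suc y) x (n - Suc y)} \<union> kept_tiles T ?p"
    using kept_tiles_west_north[of ?p x y T] by (simp add: path_from_nonempty hd_path_from)
  then have "partial_from n T (Suc x, y) = prepend [(Suc x, y), (x, y)]
      ({d \<in> T. d \<subseteq> strip (Suc y) x (n - Suc y)}, partial_from n T (x, Suc y))"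
    by (simp add: partial_from_def prepend_def path)
  then show ?thesis
    using partial_from_upper_rows[OF T, of "(x, Suc y)"] by simp
qed


text \<open>
  The three pieces of a tiling into which a vertical line in the lowest row divides it, when no
  domino crosses this line; \<open>glue_row\<close> is the inverse operation.
\<close>

lemma split_row:
  assumes T: "T \<in> tilings (rows_above n y)" and c: "c + Suc y \<le> n"
    and cross: "{(c, Suc y), (Suc c, Suc y)} \<notin> T"
  shows "{d \<in> T. d \<subseteq> strip (Suc y) 0 c} \<in> tilings (strip (Suc y) 0 c)"
    and "{d \<in> T. d \<subseteq> strip (Suc y) c (n - Suc y)} \<in> tilings (strip (Suc y) c (n - Suc y))"
    and "{d \<in> T. d \<subseteq> rows_above n (Suc y)} \<in> tilings (rows_above n (Suc y))"
proof -
  let ?L = "strip (Suc y) 0 c" and ?R = "strip (Suc y) c (n - Suc y)" and ?H = "rows_above n (Suc y)"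
  have rows: "rows_above n y = ?L \<union> ?R \<union> ?H"
    using c by (auto simp: rows_above_def staircase_def strip_def)
  have disj: "?L \<inter> ?R = {}" "?L \<inter> ?H = {}" "?R \<inter> ?H = {}"
    by (auto simp: rows_above_def strip_def)
  have one: "d \<subseteq> ?L \<or> d \<subseteq> ?R \<or> d \<subseteq> ?H" if d: "d \<in> T" for d
  proof -
    have sub: "d \<subseteq> ?L \<union> ?R \<union> ?H" using tilingsD(2)[OF T d] rows by simp
    from tilingsD(5)[OF T d] show ?thesis
    proof
      assume "monomino d"
      with sub show ?thesis by (auto simp: monomino_def)
    next
      assume "domino d"
      then obtain a b where ab: "d = {(a, b), (Suc a, b)}" by (auto simp: domino_def)
      have "\<not> (a = c \<and> b = Suc y)" using cross d ab by auto
      with sub ab show ?thesis by (auto simp: strip_def rows_above_def)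
    qed
  qed
  show "{d \<in> T. d \<subseteq> ?L} \<in> tilings ?L"
    by (rule tilings_restrict[OF T]) (use rows one disj in blast)+
  show "{d \<in> T. d \<subseteq> ?R} \<in> tilings ?R"
    by (rule tilings_restrict[OF T]) (use rows one disj in blast)+
  show "{d \<in> T. d \<subseteq> ?H} \<in> tilings ?H"
    by (rule tilings_restrict[OF T]) (use rows one disj in blast)+
qed

lemma glue_row:
  assumes U: "U \<in> tilings (strip (Suc y) 0 c)" and V: "V \<in> tilings (strip (Suc y) c (n - Suc y))"
    and T': "T' \<in> tilings (rows_above n (Suc y))" and c: "c + Suc y \<le> n"
  defines "T \<equiv> U \<union> V \<union> T'"
  shows "T \<in> tilings (rows_above n y)" and "{(c, Suc y), (Suc c, Suc y)} \<notin> T"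
    and "{d \<in> T. d \<subseteq> strip (Suc y) 0 c} = U"
    and "{d \<in> T. d \<subseteq> strip (Suc y) c (n - Suc y)} = V"
    and "{d \<in> T. d \<subseteq> rows_above n (Suc y)} = T'"
proof -
  let ?L = "strip (Suc y) 0 c" and ?R = "strip (Suc y) c (n - Suc y)" and ?H = "rows_above n (Suc y)"
  have rows: "rows_above n y = ?L \<union> ?R \<union> ?H"
    using c by (auto simp: rows_above_def staircase_def strip_def)
  have disj: "?L \<inter> ?R = {}" "?L \<inter> ?H = {}" "?R \<inter> ?H = {}"
    by (auto simp: rows_above_def strip_def)
  have UV: "U \<union> V \<in> tilings (?L \<union> ?R)" and VT: "V \<union> T' \<in> tilings (?R \<union> ?H)"
    and UT: "U \<union> T' \<in> tilings (?L \<union> ?H)"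
    using U V T' disj by (auto intro!: tilings_Un)
  have disj': "(?L \<union> ?R) \<inter> ?H = {}" "?L \<inter> (?R \<union> ?H) = {}" "?R \<inter> (?L \<union> ?H) = {}"
    "?H \<inter> (?L \<union> ?R) = {}"
    using disj by auto
  show "T \<in> tilings (rows_above n y)"
    unfolding T_def rows by (rule tilings_Un[OF UV T' disj'(1)])
  show "{(c, Suc y), (Suc c, Suc y)} \<notin> T"
    unfolding T_def using tilingsD(2)[OF U] tilingsD(2)[OF V] tilingsD(2)[OF T']
    by (fastforce simp: strip_def rows_above_def)
  have "T = U \<union> (V \<union> T')" "T = V \<union> (U \<union> T')" "T = T' \<union> (U \<union> V)"
    by (auto simp: T_def)
  then show "{d \<in> T. d \<subseteq> ?L} = U" "{d \<in> T. d \<subseteq> ?R} = V" "{d \<in> T. d \<subseteq> ?H} = T'"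
    using tiles_inside_Un[OF U VT disj'(2)] tiles_inside_Un[OF V UT disj'(3)]
      tiles_inside_Un[OF T' UV disj'(4)] by simp_all
qed

text \<open>
  The part of the lowest row to the right of the north step appears only on the left-hand
  side of the equation. For the inclusion from right to left any tiling of it will do, and one exists
  by \<open>tilings_nonempty\<close>. In \<open>partials_west\<close> the same holds for the part to the left.
\<close>

lemma partials_north:
  assumes le: "x + Suc y \<le> n"
  shows "(\<lambda>T. partial_from n T (x, y)) ` {T \<in> tilings (rows_above n y). north_allowed n T (x, y)}
    = prepend [(x, y)] ` (tilings (strip (Suc y) 0 x) \<times> partials n (x, Suc y))" (is "?l = ?r")
proof
  show "?l \<subseteq> ?r"
  proof
    fix B assume "B \<in> ?l"
    then obtain T where T: "T \<in> tilings (rows_above n y)" and na: "north_allowed n T (x, y)"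
      and B: "B = partial_from n T (x, y)" by auto
    from na have cross: "{(x, Suc y), (Suc x, Suc y)} \<notin> T" by (simp add: north_allowed_def)
    show "B \<in> ?r"
      unfolding B partial_from_north[OF T na] partials_def
      using split_row(1,3)[OF T le cross] by (intro imageI) auto
  qed
  show "?r \<subseteq> ?l"
  proof
    fix B assume "B \<in> ?r"
    then obtain U T' where U: "U \<in> tilings (strip (Suc y) 0 x)"
      and T': "T' \<in> tilings (rows_above n (Suc y))"
      and B: "B = prepend [(x, y)] (U, partial_from n T' (x, Suc y))"
      by (auto simp: partials_def)
    obtain V where V: "V \<in> tilings (strip (Suc y) x (n - Suc y))"
      using tilings_nonempty by blast
    note g = glue_row[OF U V T' le]
    have na: "north_allowed n (U \<union> V \<union> T') (x, y)"
      using g(2) le by (simp add: north_allowed_def)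
    have "B = partial_from n (U \<union> V \<union> T') (x, y)"
      unfolding partial_from_north[OF g(1) na] g(3) g(5) B ..
    with g(1) na show "B \<in> ?l" by blast
  qed
qed

text \<open>
  The two alternatives are the two reasons for a west step: the edge of the diagram, in which case
  the strip is empty, and a domino.
\<close>

lemma partials_west:
  assumes le: "Suc x + y \<le> n"
  shows "(\<lambda>T. partial_from n T (Suc x, y)) `
      {T \<in> tilings (rows_above n y). \<not> north_allowed n T (Suc x, y)}
    = prepend [(Suc x, y), (x, y)] `
      ({V \<in> tilings (strip (Suc y) x (n - Suc y)).
          Suc x + y = n \<or> {(Suc x, Suc y), (Suc (Suc x), Suc y)} \<in> V} \<times> partials n (x, Suc y))"
    (is "?l = ?r")
proof
  let ?D = "{(Suc x, Suc y), (Suc (Suc x), Suc y)}"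
  have na: "\<not> north_allowed n T (Suc x, y) \<longleftrightarrow> Suc x + y = n \<or> ?D \<in> T" for T
    using le by (auto simp: north_allowed_def)
  have le': "x + Suc y \<le> n" using le by simp
  show "?l \<subseteq> ?r"
  proof
    fix B assume "B \<in> ?l"
    then obtain T where T: "T \<in> tilings (rows_above n y)" and nn: "\<not> north_allowed n T (Suc x, y)"
      and B: "B = partial_from n T (Suc x, y)" by auto
    have sub: "?D \<subseteq> strip (Suc y) x (n - Suc y)" if "?D \<in> T"
      using tilingsD(2)[OF T that] by (auto simp: rows_above_def staircase_def strip_def)
    have cross: "{(x, Suc y), (Suc x, Suc y)} \<notin> T" (is "?E \<notin> T")
    proof
      assume E: "?E \<in> T"
      then have "(Suc x, Suc y) \<in> rows_above n y" using tilingsD(2)[OF T] by blast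
      then have "Suc x + y \<noteq> n" by (auto simp: rows_above_def staircase_def)
      with nn na have "?D \<in> T" by simp
      with E have "?D = ?E" using tilingsD(4)[OF T, of ?D ?E "(Suc x, Suc y)"] by simp
      then show False by (simp add: doubleton_eq_iff)
    qed
    show "B \<in> ?r"
      unfolding B partial_from_west[OF T le nn] partials_def
      using split_row(2,3)[OF T le' cross] nn[unfolded na] sub by (intro imageI) auto
  qed
  show "?r \<subseteq> ?l"
  proof
    fix B assume "B \<in> ?r"
    then obtain V T' where V: "V \<in> tilings (strip (Suc y) x (n - Suc y))"
      and D: "Suc x + y = n \<or> ?D \<in> V"
      and T': "T' \<in> tilings (rows_above n (Suc y))"
      and B: "B = prepend [(Suc x, y), (x, y)] (V, partial_from n T' (x, Suc y))"
      by (auto simp: partials_def)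
    obtain U where U: "U \<in> tilings (strip (Suc y) 0 x)"
      using tilings_nonempty by blast
    note g = glue_row[OF U V T' le']
    have nn: "\<not> north_allowed n (U \<union> V \<union> T') (Suc x, y)"
      using D unfolding na by blast
    have "B = partial_from n (U \<union> V \<union> T') (Suc x, y)"
      unfolding partial_from_west[OF g(1) le nn] g(4) g(5) B ..
    with g(1) nn show "B \<in> ?l" by blast
  qed
qed

section \<open>Summing the weights\<close>

lemma partialsD:
  assumes "B \<in> partials n (x, y)"
  shows "fst B \<noteq> []" and "hd (fst B) = (x, y)"
    and "\<exists>T \<in> tilings (rows_above n y). snd B \<subseteq> T"
proof -
  from assms obtain T where "T \<in> tilings (rows_above n y)" and "B = partial_from n T (x, y)"
    by (auto simp: partials_def)
  with kept_tiles_subset[of T "path_from n T (x, y)"]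
  show "fst B \<noteq> []" "hd (fst B) = (x, y)" "\<exists>T \<in> tilings (rows_above n y). snd B \<subseteq> T"
    by (auto simp: partial_from_def path_from_nonempty hd_path_from)
qed

text \<open>
  The kept tiles of the row and those of the rows above can be told apart by their position, so
  \<open>prepend u\<close> is injective, and the weight of a union is the product of the weights.
\<close>

lemma sum_prepend:
  assumes X: "X \<subseteq> tilings (strip (Suc y) l r)"
  shows "(\<Sum>B \<in> prepend u ` (X \<times> partials n (x, Suc y)). wt B)
    = (\<Sum>U \<in> X. tile_weight U) * (\<Sum>B \<in> partials n (x, Suc y). wt B)"
proof -
  let ?A = "strip (Suc y) l r" and ?P = "partials n (x, Suc y)"
  have low: "d \<subseteq> ?A" if "U \<in> X" "d \<in> U" for U d
    using that X tilingsD(2) by blast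
  have high: "\<not> d \<subseteq> ?A" if B: "B \<in> ?P" and d: "d \<in> snd B" for B d
  proof -
    from partialsD(3)[OF B] d obtain T where "T \<in> tilings (rows_above n (Suc y))" "d \<in> T" by blast
    then have "d \<subseteq> rows_above n (Suc y)" "d \<noteq> {}" using tilingsD(2,3) by blast+
    then show ?thesis by (auto simp: rows_above_def strip_def)
  qed
  have lower_part: "{d \<in> U \<union> snd B. d \<subseteq> ?A} = U" and upper_part: "{d \<in> U \<union> snd B. \<not> d \<subseteq> ?A} = snd B"
    if "U \<in> X" "B \<in> ?P" for U B
    using low[OF that(1)] high[OF that(2)] by auto
  have inj: "inj_on (prepend u) (X \<times> ?P)"
  proof (rule inj_onI)
    fix z z' assume "z \<in> X \<times> ?P" and "z' \<in> X \<times> ?P" and eq: "prepend u z = prepend u z'"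
    then obtain U B U' B' where z: "z = (U, B)" "z' = (U', B')"
      and mem: "U \<in> X" "B \<in> ?P" "U' \<in> X" "B' \<in> ?P" by auto
    from eq have p: "fst B = fst B'" and UK: "U \<union> snd B = U' \<union> snd B'"
      by (simp_all add: z prepend_def split: prod.splits)
    have "U = U'" using lower_part[OF mem(1,2)] lower_part[OF mem(3,4)] by (simp only: UK)
    moreover have "snd B = snd B'"
      using upper_part[OF mem(1,2)] upper_part[OF mem(3,4)] by (simp only: UK)
    ultimately show "z = z'" using p by (simp add: z prod_eq_iff)
  qed
  have mult: "wt (prepend u (U, B)) = tile_weight U * wt B" if UB: "U \<in> X" "B \<in> ?P" for U B
  proof -
    have "finite U" using UB(1) X finite_tiling[OF finite_strip] by blast
    moreover have "finite (snd B)"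
      using partialsD(3)[OF UB(2)] finite_tiling[OF finite_rows_above] finite_subset by metis
    moreover have "U \<inter> snd B = {}" using low[OF UB(1)] high[OF UB(2)] by blast
    ultimately have "tile_weight (U \<union> snd B) = tile_weight U * tile_weight (snd B)"
      by (rule tile_weight_Un)
    then show ?thesis by (cases B) (simp add: prepend_def wt_def tile_weight_def)
  qed
  have "(\<Sum>B \<in> prepend u ` (X \<times> ?P). wt B) = (\<Sum>(U, B) \<in> X \<times> ?P. tile_weight U * wt B)"
    unfolding sum.reindex[OF inj] by (rule sum.cong) (auto simp: mult)
  then show ?thesis by (simp add: sum_product sum.cartesian_product)
qed

lemma partials_by_first_step:
  "partials n (x, y)
    = (\<lambda>T. partial_from n T (x, y)) ` {T \<in> tilings (rows_above n y). north_allowed n T (x, y)}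
    \<union> (\<lambda>T. partial_from n T (x, y)) ` {T \<in> tilings (rows_above n y). \<not> north_allowed n T (x, y)}"
  by (auto simp: partials_def)

lemma sum_partials_top: "(\<Sum>B \<in> partials n (0, n). wt B) = 1"
proof -
  have "rows_above n n = {}" by (auto simp: rows_above_def staircase_def)
  moreover have "path_from n {} (0, n) = [(0, n)]"
    by (simp add: path_from.simps north_allowed_def)
  ultimately have "partials n (0, n) = {([(0, n)], {})}"
    by (auto simp: partials_def tilings_empty partial_from_def kept_tiles_def)
  then show ?thesis by (simp add: wt_def)
qed

text \<open>
  On the \<open>y\<close>-axis nothing can block the way north, since a blocking domino would have to cover a box
  in column \<open>0\<close>.
\<close>

lemma sum_partials_axis:
  assumes "Suc y \<le> n"
  shows "(\<Sum>B \<in> partials n (0, y). wt B) = (\<Sum>B \<in> partials n (0, Suc y). wt B)"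
proof -
  have "north_allowed n T (0, y)" if T: "T \<in> tilings (rows_above n y)" for T
    using assms tilingsD(2)[OF T, of "{(0, Suc y), (Suc 0, Suc y)}"]
    by (auto simp: north_allowed_def rows_above_def staircase_def)
  then have "partials n (0, y) = prepend [(0, y)] ` (tilings (strip (Suc y) 0 0) \<times> partials n (0, Suc y))"
    using partials_by_first_step[of n 0 y] partials_north[of 0 y n] assms by auto
  then show ?thesis
    using sum_tilings_strip[of "Suc y" 0 0] by (simp add: sum_prepend[OF order_refl])
qed

lemma sum_partials_boundary:
  assumes "Suc x + y = n"
  shows "(\<Sum>B \<in> partials n (Suc x, y). wt B) = (\<Sum>B \<in> partials n (x, Suc y). wt B)"
proof -
  have "\<not> north_allowed n T (Suc x, y)" for T
    using assms by (auto simp: north_allowed_def)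
  then have "partials n (Suc x, y) = prepend [(Suc x, y), (x, y)] `
      (tilings (strip (Suc y) x (n - Suc y)) \<times> partials n (x, Suc y))"
    using partials_by_first_step[of n "Suc x" y] partials_west[of x y n] assms by simp
  moreover have "n - Suc y = x + 0" using assms by simp
  ultimately show ?thesis
    using sum_tilings_strip[of "Suc y" x 0] by (simp add: sum_prepend[OF order_refl])
qed

lemma sum_partials_interior:
  assumes "Suc x + Suc y \<le> n"
  shows "(\<Sum>B \<in> partials n (Suc x, y). wt B)
    = lucas (Suc (Suc x)) * (\<Sum>B \<in> partials n (Suc x, Suc y). wt B)
    + var_t * lucas (n - Suc y - Suc x) * (\<Sum>B \<in> partials n (x, Suc y). wt B)"
proof -
  let ?X = "tilings (strip (Suc y) 0 (Suc x))"
  let ?Y = "{V \<in> tilings (strip (Suc y) x (n - Suc y)). {(Suc x, Suc y), (Suc (Suc x), Suc y)} \<in> V}"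
  let ?N = "prepend [(Suc x, y)] ` (?X \<times> partials n (Suc x, Suc y))"
  let ?W = "prepend [(Suc x, y), (x, y)] ` (?Y \<times> partials n (x, Suc y))"
  have split: "partials n (Suc x, y) = ?N \<union> ?W"
    using partials_by_first_step[of n "Suc x" y] partials_north[of "Suc x" y n] partials_west[of x y n]
      assms by simp
  have N: "fst B ! 1 = (Suc x, Suc y)" if "B \<in> ?N" for B
    using that partialsD(1,2)[of _ n "Suc x" "Suc y"]
    by (fastforce simp: prepend_def hd_conv_nth)
  have W: "fst B ! 1 = (x, y)" if "B \<in> ?W" for B
    using that by (auto simp: prepend_def)
  \<comment> \<open>The two kinds of partial tilings differ in the second point of the path.\<close>
  have disj: "?N \<inter> ?W = {}"
  proof (rule equals0I)
    fix B assume B: "B \<in> ?N \<inter> ?W"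
    have "fst B ! 1 = (Suc x, Suc y)" by (rule N[OF IntD1[OF B]])
    moreover have "fst B ! 1 = (x, y)" by (rule W[OF IntD2[OF B]])
    ultimately show False by simp
  qed
  have "finite (?N \<union> ?W)" unfolding split[symmetric] by (rule finite_partials)
  then have fin: "finite ?N" "finite ?W" by (simp_all only: finite_Un)
  have "(\<Sum>B \<in> partials n (Suc x, y). wt B) = (\<Sum>B \<in> ?N. wt B) + (\<Sum>B \<in> ?W. wt B)"
    unfolding split by (rule sum.union_disjoint[OF fin disj])
  also have "(\<Sum>B \<in> ?N. wt B) = lucas (Suc (Suc x)) * (\<Sum>B \<in> partials n (Suc x, Suc y). wt B)"
    using sum_tilings_strip[of "Suc y" 0 "Suc x"] by (simp add: sum_prepend[OF order_refl])
  also have "(\<Sum>B \<in> ?W. wt B) = var_t * lucas (n - Suc y - Suc x) * (\<Sum>B \<in> partials n (x, Suc y). wt B)"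
  proof -
    have "(\<Sum>B \<in> ?W. wt B) = (\<Sum>U \<in> ?Y. tile_weight U) * (\<Sum>B \<in> partials n (x, Suc y). wt B)"
      by (rule sum_prepend) auto
    moreover have "x < n - Suc y" using assms by simp
    ultimately show ?thesis by (simp only: sum_tilings_strip_domino_first)
  qed
  finally show ?thesis .
qed

text \<open>
  The multiplied-out form of \<open>W(x, y) = {j}! / ({x}! {j - x}!)\<close>, where \<open>j = n - y\<close> is the
  number of rows that remain.
\<close>

lemma sum_partials:
  assumes "y + j = n" and "x \<le> j"
  shows "(\<Sum>B \<in> partials n (x, y). wt B) * lucas_fact x * lucas_fact (j - x) = lucas_fact j"
  using assms
proof (induction j arbitrary: x y)
  case 0
  then show ?case by (simp add: sum_partials_top lucas_fact_def)
next
  case (Suc j)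
  have n: "Suc y + j = n" using Suc.prems by simp
  show ?case
  proof (cases x)
    case 0
    then show ?thesis
      using Suc.IH[OF n, of 0] n sum_partials_axis[of y n]
      by (simp add: lucas_fact_Suc lucas_fact_nonzero algebra_simps)
  next
    case x: (Suc x')
    show ?thesis
    proof (cases "x' = j")
      case True
      then show ?thesis
        using Suc.IH[OF n, of j] n sum_partials_boundary[of j y n] x
        by (simp add: lucas_fact_Suc lucas_fact_nonzero algebra_simps)
    next
      case False
      with Suc.prems x obtain m where m: "j = Suc x' + m"
        by (metis Suc_le_mono le_neq_implies_less less_eqE Suc_leI)
      let ?W1 = "\<Sum>B \<in> partials n (Suc x', Suc y). wt B"
      let ?W2 = "\<Sum>B \<in> partials n (x', Suc y). wt B"
      have IH1: "?W1 * lucas_fact (Suc x') * lucas_fact m = lucas_fact j"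
        using Suc.IH[OF n, of "Suc x'"] m by simp
      have "j - x' = Suc m" using m by simp
      then have IH2: "?W2 * lucas_fact x' * lucas_fact (Suc m) = lucas_fact j"
        using Suc.IH[OF n, of x'] m by simp
      have "n - Suc y - Suc x' = m" using n m by simp
      then have W: "(\<Sum>B \<in> partials n (Suc x', y). wt B)
        = lucas (Suc (Suc x')) * ?W1 + var_t * lucas m * ?W2"
        using sum_partials_interior[of x' y n] n m by simp
      have "Suc j - x = Suc m" using m x by simp
      then have "(\<Sum>B \<in> partials n (x, y). wt B) * lucas_fact x * lucas_fact (Suc j - x)
        = lucas (Suc (Suc x')) * lucas (Suc m) * (?W1 * lucas_fact (Suc x') * lucas_fact m)
        + var_t * lucas (Suc x') * lucas m * (?W2 * lucas_fact x' * lucas_fact (Suc m))"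
        by (simp only: x W) (simp only: lucas_fact_Suc algebra_simps)
      also have "\<dots> = lucas (Suc x' + Suc m) * lucas_fact j"
        unfolding IH1 IH2 lucas_add by (simp only: algebra_simps)
      also have "\<dots> = lucas_fact (Suc j)"
        using m by (simp add: lucas_fact_Suc mult.commute)
      finally show ?thesis .
    qed
  qed
qed

lemma binomial_partial_tilings_eq_partials: "binomial_partial_tilings n k = partials n (k, 0)"
proof -
  have "rows_above n 0 = staircase n" by (auto simp: rows_above_def staircase_def)
  then have "{T. tiling n T} = tilings (rows_above n 0)"
    by (auto simp: tiling_def tilings_def)
  then show ?thesis
    by (simp add: binomial_partial_tilings_def partials_def binomial_partial_tiling_def
        partial_from_def tiling_path_def)
qed

theorem corollary2p2:
  fixes n k :: nat
  assumes "k \<le> n"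
  shows "lucasnomial n k = (\<Sum>B \<in> binomial_partial_tilings n k. to_fract (wt B)) \<and>
         lucasnomial n k \<in> to_fract ` nat_polys"
proof -
  let ?S = "\<Sum>B \<in> binomial_partial_tilings n k. wt B"
  have "?S * (lucas_fact k * lucas_fact (n - k)) = lucas_fact n"
    using sum_partials[of 0 n n k] assms
    by (simp add: binomial_partial_tilings_eq_partials mult.assoc)
  then have "to_fract ?S * (to_fract (lucas_fact k) * to_fract (lucas_fact (n - k)))
    = to_fract (lucas_fact n)"
    by (simp only: to_fract_mult[symmetric])
  then have "lucasnomial n k = to_fract ?S"
    by (simp add: lucasnomial_def lucas_fact_nonzero nonzero_divide_eq_eq)
  moreover have "to_fract ?S = (\<Sum>B \<in> binomial_partial_tilings n k. to_fract (wt B))"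
    by simp
  moreover have "?S \<in> nat_polys" by (intro nat_polys_sum wt_in_nat_polys)
  ultimately show ?thesis by (metis imageI)
qed

end
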